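(* There exists a constant $c_{\rm H}>0$, independent of $K$, such that bounds (i) and (ii) below both hold in the following setting. Let $f:\mathbb{R}^d\to\mathbb{R}\cup\{+\infty\}$ be proper, closed, convex and $L$-Lipschitz smooth ($L>0$), with nonempty solution set, $f_*=\min f$, let $\mathbf{x}_*$ be a minimizer and $\|\mathbf{x}_0-\mathbf{x}_*\|\le R$. Let $K\ge1$ and let the inexact gradients satisfy $\tilde\nabla f(\mathbf{x}_k)=\nabla f(\mathbf{x}_k)+\mathbf{e}_k$, $\|\mathbf{e}_k\|^2\le b_k^2$, $b_k\ge0$, $k=0,\dots,K-1$. (i) (this only fixes which constant is meant) The iterate $\mathbf{x}_K$ of iFGM satisfies $f(\mathbf{x}_K)-f_*-\frac{1}{2L}\|\nabla f(\mathbf{x}_K)\|^2\le\frac{4LR^2}{A_K}+\frac{2c_{\rm H}}{L}\sum_{i=0}^{K-1}\alpha_{i+1}b_i^2$. (ii) The iterate $\mathbf{x}_K$ of iOGM satisfies $$f(\mathbf{x}_K)-f_*-\frac{1}{2L}\|\nabla f(\mathbf{x}_K)\|^2\le\frac{4LR^2}{A_K}+\frac{8c_{\rm H}}{L}\sum_{i=0}^{K-1}\alpha_{i+1}b_i^2.$$ In particular, if $b_i\equiv b$, then for iOGM $$f(\mathbf{x}_K)-f_*-\frac{1}{2L}\|\nabla f(\mathbf{x}_K)\|^2\le\mathcal{O}\left(\frac{LR^2}{K^2}+\frac{K^2b^2}{L}\right),$$ i.e. the left-hand side is at most $C\left(\frac{LR^2}{K^2}+\frac{K^2b^2}{L}\right)$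 for a constant $C$ independent of $K$, $L$, $R$ and $b$.
   Context: For $s\in\{1,2\}$ consider: $\mathbf{z}_0=\mathbf{x}_0\in\mathbb{R}^d$, $A_0=\alpha_0=1$, and for $k=0,\dots,K-1$: $$\mathbf{y}_{k+1}=\mathbf{x}_k-\tfrac1L\tilde\nabla f(\mathbf{x}_k),\qquad \mathbf{z}_{k+1}=\mathbf{z}_k-\tfrac sL\alpha_k\tilde\nabla f(\mathbf{x}_k),$$ $$\alpha_{k+1}=\frac{1+\sqrt{4A_k+1}}{2},\qquad A_{k+1}=A_k+\alpha_{k+1},\qquad \mathbf{x}_{k+1}=\Big(1-\frac{\alpha_{k+1}}{A_{k+1}}\Big)\mathbf{y}_{k+1}+\frac{\alpha_{k+1}}{A_{k+1}}\mathbf{z}_{k+1}.$$ These give $A_k=\alpha_k^2$. The case $s=2$ is iOGM (the Inexact Generalized Optimized Gradient Method with $\lambda_k\equiv1$); the case $s=1$ is iFGM (the Inexact Generalized Fast Gradient Method with $\lambda_k\equiv1$). "$L$-Lipschitz smooth" means differentiable with $L$-Lipschitz gradient; $\|\cdot\|$ is the Euclidean norm. *)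

theory Defs
  imports "HOL-Analysis.Analysis" "HOL-Library.Poly_Mapping"
begin

text \<open>
  The constants of the theorem do not depend on the dimension \<open>d\<close>, so \<open>d\<close> has to be quantified
  inside the statement and cannot be a type. All spaces \<open>\<real>\<^sup>d\<close> are therefore realised as subspaces
  of one inner product space: the finitely supported sequences \<open>nat \<Rightarrow>\<^sub>0 real\<close> with the Euclidean
  inner product, \<open>\<real>\<^sup>d\<close> being the sequences supported in \<open>{..<d}\<close>.
\<close>

instantiation poly_mapping :: (type, real_inner) real_inner
begin

lift_definition scaleR_poly_mapping :: "real \<Rightarrow> ('a \<Rightarrow>\<^sub>0 'b) \<Rightarrow> ('a \<Rightarrow>\<^sub>0 'b)"
  is "\<lambda>c f k. c *\<^sub>R f k"
  by (rule finite_subset) auto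

definition inner_poly_mapping :: "('a \<Rightarrow>\<^sub>0 'b) \<Rightarrow> ('a \<Rightarrow>\<^sub>0 'b) \<Rightarrow> real" where
  "inner_poly_mapping x y =
     (\<Sum>k\<in>Poly_Mapping.keys x. Poly_Mapping.lookup x k \<bullet> Poly_Mapping.lookup y k)"

definition norm_poly_mapping :: "('a \<Rightarrow>\<^sub>0 'b) \<Rightarrow> real" where
  "norm_poly_mapping x = sqrt (x \<bullet> x)"

definition dist_poly_mapping :: "('a \<Rightarrow>\<^sub>0 'b) \<Rightarrow> ('a \<Rightarrow>\<^sub>0 'b) \<Rightarrow> real" where
  "dist_poly_mapping x y = norm (x - y)"

definition sgn_poly_mapping :: "('a \<Rightarrow>\<^sub>0 'b) \<Rightarrow> ('a \<Rightarrow>\<^sub>0 'b)" where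
  "sgn_poly_mapping x = inverse (norm x) *\<^sub>R x"

definition uniformity_poly_mapping :: "(('a \<Rightarrow>\<^sub>0 'b) \<times> ('a \<Rightarrow>\<^sub>0 'b)) filter" where
  "uniformity_poly_mapping = (INF e\<in>{0 <..}. principal {(x, y). dist x y < e})"

definition open_poly_mapping :: "('a \<Rightarrow>\<^sub>0 'b) set \<Rightarrow> bool" where
  "open_poly_mapping U \<longleftrightarrow> (\<forall>x\<in>U. eventually (\<lambda>(x', y). x' = x \<longrightarrow> y \<in> U) uniformity)"

instance
proof
  have inner_eq: "x \<bullet> y = (\<Sum>k\<in>S. Poly_Mapping.lookup x k \<bullet> Poly_Mapping.lookup y k)"
    if "finite S" "Poly_Mapping.keys x \<subseteq> S" for S and x y :: "'a \<Rightarrow>\<^sub>0 'b"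
    unfolding inner_poly_mapping_def using that
    by (intro sum.mono_neutral_left) (auto simp: in_keys_iff)
  fix a b :: real and x y z :: "'a \<Rightarrow>\<^sub>0 'b"
  show "a *\<^sub>R (x + y) = a *\<^sub>R x + a *\<^sub>R y"
    by transfer (simp add: scaleR_add_right)
  show "(a + b) *\<^sub>R x = a *\<^sub>R x + b *\<^sub>R x"
    by transfer (simp add: scaleR_add_left)
  show "a *\<^sub>R b *\<^sub>R x = (a * b) *\<^sub>R x"
    by transfer simp
  show "1 *\<^sub>R x = x"
    by transfer simp
  show "sgn x = inverse (norm x) *\<^sub>R x"
    by (rule sgn_poly_mapping_def)
  show "dist x y = norm (x - y)"
    by (rule dist_poly_mapping_def)
  show "(uniformity :: (('a \<Rightarrow>\<^sub>0 'b) \<times> ('a \<Rightarrow>\<^sub>0 'b)) filter)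
      = (INF e\<in>{0 <..}. principal {(x, y). dist x y < e})"
    by (rule uniformity_poly_mapping_def)
  show "open U \<longleftrightarrow> (\<forall>x\<in>U. eventually (\<lambda>(x', y). x' = x \<longrightarrow> y \<in> U) uniformity)"
    for U :: "('a \<Rightarrow>\<^sub>0 'b) set"
    by (rule open_poly_mapping_def)
  define S where
    "S = Poly_Mapping.keys x \<union> Poly_Mapping.keys y \<union> Poly_Mapping.keys (x + y)
       \<union> Poly_Mapping.keys (a *\<^sub>R x)"
  have S: "finite S" "Poly_Mapping.keys x \<subseteq> S" "Poly_Mapping.keys y \<subseteq> S"
      "Poly_Mapping.keys (x + y) \<subseteq> S" "Poly_Mapping.keys (a *\<^sub>R x) \<subseteq> S"
    by (auto simp: S_def)
  show "x \<bullet> y = y \<bullet> x"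
    by (simp add: inner_eq[OF S(1) S(2)] inner_eq[OF S(1) S(3)] inner_commute)
  show "(x + y) \<bullet> z = x \<bullet> z + y \<bullet> z"
    by (simp add: inner_eq[OF S(1) S(2)] inner_eq[OF S(1) S(3)] inner_eq[OF S(1) S(4)]
        lookup_add inner_add_left sum.distrib)
  show "(a *\<^sub>R x) \<bullet> y = a * (x \<bullet> y)"
    by (simp add: inner_eq[OF S(1) S(2)] inner_eq[OF S(1) S(5)] scaleR_poly_mapping.rep_eq
        sum_distrib_left)
  show "0 \<le> x \<bullet> x"
    unfolding inner_poly_mapping_def by (rule sum_nonneg) simp
  show "x \<bullet> x = 0 \<longleftrightarrow> x = 0"
    unfolding inner_poly_mapping_def
    by (subst sum_nonneg_eq_0_iff) (auto simp: in_keys_iff intro!: poly_mapping_eqI)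
  show "norm x = sqrt (x \<bullet> x)"
    by (rule norm_poly_mapping_def)
qed

end

definition Rn :: "nat \<Rightarrow> (nat \<Rightarrow>\<^sub>0 real) set" where
  "Rn d = {x. Poly_Mapping.keys x \<subseteq> {..<d}}"

lemma inner_Rn:
  assumes "x \<in> Rn d"
  shows "x \<bullet> y = (\<Sum>i<d. Poly_Mapping.lookup x i * Poly_Mapping.lookup y i)"
  unfolding inner_poly_mapping_def inner_real_def using assms
  by (intro sum.mono_neutral_left) (auto simp: Rn_def in_keys_iff)

lemma subspace_Rn: "subspace (Rn d)"
  unfolding subspace_def Rn_def
  by (auto simp: in_keys_iff scaleR_poly_mapping.rep_eq dest!: subsetD[OF keys_add])

lemma Rn_coordinates:
  "bij_betw Poly_Mapping.lookup (Rn d) {v. \<forall>i\<ge>d. v i = 0}"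
proof (rule bij_betwI')
  show "(Poly_Mapping.lookup x = Poly_Mapping.lookup y) = (x = y)"
    for x y :: "nat \<Rightarrow>\<^sub>0 real"
    by (metis poly_mapping_eqI)
  show "Poly_Mapping.lookup x \<in> {v. \<forall>i\<ge>d. v i = 0}" if "x \<in> Rn d" for x
    using that by (force simp: Rn_def in_keys_iff subset_iff)
  show "\<exists>x\<in>Rn d. v = Poly_Mapping.lookup x" if "v \<in> {v. \<forall>i\<ge>d. v i = 0}" for v :: "nat \<Rightarrow> real"
  proof -
    have sub: "{i. v i \<noteq> 0} \<subseteq> {..<d}"
      using that by (auto simp: not_le[symmetric])
    then have "Poly_Mapping.lookup (Poly_Mapping.Abs_poly_mapping v) = v"
      by (intro lookup_Abs_poly_mapping) (rule finite_subset, auto)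
    with sub show ?thesis
      by (intro bexI[of _ "Poly_Mapping.Abs_poly_mapping v"]) (auto simp: Rn_def in_keys_iff)
  qed
qed

definition epi_on :: "'a set \<Rightarrow> ('a \<Rightarrow> ereal) \<Rightarrow> ('a \<times> real) set" where
  "epi_on S f = {(x, t). x \<in> S \<and> f x \<le> ereal t}"

definition proper_on :: "'a set \<Rightarrow> ('a \<Rightarrow> ereal) \<Rightarrow> bool" where
  "proper_on S f \<longleftrightarrow> (\<forall>x\<in>S. f x \<noteq> -\<infinity>) \<and> (\<exists>x\<in>S. f x \<noteq> \<infinity>)"

definition closed_fun_on :: "'a::topological_space set \<Rightarrow> ('a \<Rightarrow> ereal) \<Rightarrow> bool" where
  "closed_fun_on S f \<longleftrightarrow> closedin (top_of_set (S \<times> UNIV)) (epi_on S f)"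

definition convex_fun_on :: "'a::real_vector set \<Rightarrow> ('a \<Rightarrow> ereal) \<Rightarrow> bool" where
  "convex_fun_on S f \<longleftrightarrow> convex (epi_on S f)"

text \<open>
  \<open>lipschitz_smooth_on S L f f'\<close>: \<open>f\<close> is finite and differentiable on all of the subspace \<open>S\<close>, with
  gradient map \<open>f'\<close>, and \<open>f'\<close> is \<open>L\<close>-Lipschitz. The derivative is taken within \<open>S\<close>,
  and \<open>f' x \<in> S\<close> makes the gradient at \<open>x\<close> unique.
\<close>

definition lipschitz_smooth_on ::
    "'a::real_inner set \<Rightarrow> real \<Rightarrow> ('a \<Rightarrow> ereal) \<Rightarrow> ('a \<Rightarrow> 'a) \<Rightarrow> bool" where
  "lipschitz_smooth_on S L f f' \<longleftrightarrow>
     (\<forall>x\<in>S. \<bar>f x\<bar> \<noteq> \<infinity> \<and> f' x \<in> S \<and>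
        ((\<lambda>u. real_of_ereal (f u)) has_derivative (\<lambda>h. f' x \<bullet> h)) (at x within S)) \<and>
     L-lipschitz_on S f'"

fun A_coeff :: "nat \<Rightarrow> real" and \<alpha>_coeff :: "nat \<Rightarrow> real" where
  "A_coeff 0 = 1"
| "A_coeff (Suc k) = A_coeff k + \<alpha>_coeff (Suc k)"
| "\<alpha>_coeff 0 = 1"
| "\<alpha>_coeff (Suc k) = (1 + sqrt (4 * A_coeff k + 1)) / 2"

text \<open>
  \<open>K\<close> steps of the scheme with parameter \<open>s\<close>, where \<open>g k\<close> is the inexact gradient used at \<open>x k\<close>.
\<close>

definition inexact_method ::
    "real \<Rightarrow> real \<Rightarrow> nat \<Rightarrow> (nat \<Rightarrow> 'a) \<Rightarrow>
     (nat \<Rightarrow> 'a) \<Rightarrow> (nat \<Rightarrow> 'a) \<Rightarrow> (nat \<Rightarrow> 'a::real_vector) \<Rightarrow> bool" where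
  "inexact_method s L K g x y z \<longleftrightarrow>
     z 0 = x 0 \<and>
     (\<forall>k<K.
        y (Suc k) = x k - (1 / L) *\<^sub>R g k \<and>
        z (Suc k) = z k - (s / L * \<alpha>_coeff k) *\<^sub>R g k \<and>
        x (Suc k) = (1 - \<alpha>_coeff (Suc k) / A_coeff (Suc k)) *\<^sub>R y (Suc k)
                    + (\<alpha>_coeff (Suc k) / A_coeff (Suc k)) *\<^sub>R z (Suc k))"

abbreviation "iFGM \<equiv> inexact_method 1"
abbreviation "iOGM \<equiv> inexact_method 2"

definition problem_setting ::
    "nat \<Rightarrow> real \<Rightarrow> real \<Rightarrow> ((nat \<Rightarrow>\<^sub>0 real) \<Rightarrow> ereal) \<Rightarrow> ((nat \<Rightarrow>\<^sub>0 real) \<Rightarrow> (nat \<Rightarrow>\<^sub>0 real)) \<Rightarrow>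
     (nat \<Rightarrow>\<^sub>0 real) \<Rightarrow> (nat \<Rightarrow>\<^sub>0 real) \<Rightarrow> bool" where
  "problem_setting d L R f f' x\<^sub>0 x\<^sub>s \<longleftrightarrow>
     L > 0 \<and>
     proper_on (Rn d) f \<and> closed_fun_on (Rn d) f \<and> convex_fun_on (Rn d) f \<and>
     lipschitz_smooth_on (Rn d) L f f' \<and>
     x\<^sub>s \<in> Rn d \<and> (\<forall>u\<in>Rn d. f x\<^sub>s \<le> f u) \<and>
     x\<^sub>0 \<in> Rn d \<and> norm (x\<^sub>0 - x\<^sub>s) \<le> R"

definition error_bound :: "nat \<Rightarrow> nat \<Rightarrow> (nat \<Rightarrow> (nat \<Rightarrow>\<^sub>0 real)) \<Rightarrow> (nat \<Rightarrow> real) \<Rightarrow> bool" where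
  "error_bound d K e b \<longleftrightarrow> (\<forall>k<K. e k \<in> Rn d \<and> 0 \<le> b k \<and> (norm (e k))\<^sup>2 \<le> (b k)\<^sup>2)"

definition reduced_gap ::
    "nat \<Rightarrow> real \<Rightarrow> ((nat \<Rightarrow>\<^sub>0 real) \<Rightarrow> ereal) \<Rightarrow> ((nat \<Rightarrow>\<^sub>0 real) \<Rightarrow> (nat \<Rightarrow>\<^sub>0 real)) \<Rightarrow>
     (nat \<Rightarrow>\<^sub>0 real) \<Rightarrow> real" where
  "reduced_gap d L f f' u =
     real_of_ereal (f u) - real_of_ereal (INF v\<in>Rn d. f v) - 1 / (2 * L) * (norm (f' u))\<^sup>2"

end

theory Submission
  imports Defs
begin

text \<open>
  For \<open>s \<in> [1, 2]\<close> the potential \<open>A k * gap k + L / (2 * s) * \<parallel>z (k + 1) - x\<^sub>*\<parallel>\<^sup>2\<close> is nonincreasing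
  when the gradients are exact. With errors, its increase in one step consists of inner products of
  \<open>e k\<close> with \<open>z k - x\<^sub>*\<close> and with gradients. For \<open>s = 2\<close> no negative multiple of
  \<open>\<parallel>\<nabla>f (x k)\<parallel>\<^sup>2\<close> remains to absorb the latter, but the gradients are themselves controlled by the
  iterates, \<open>s * \<alpha> k * (\<nabla>f (x k) + e k) = L * (z k - z (k + 1))\<close>. Hence the accumulated error is
  at most of order \<open>D * (\<Sum>i<K. \<alpha> (i + 1) * \<parallel>e i\<parallel>)\<close> with \<open>D = max \<parallel>z i - x\<^sub>*\<parallel>\<close>, up to second-order
  terms. The potential also bounds \<open>D\<^sup>2\<close>, so \<open>D\<close> can be absorbed, and Cauchy-Schwarz with
  \<open>(\<Sum>i<K. \<alpha> (i + 1)) \<le> A K\<close> turns the squared sum into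
  \<open>A K * (\<Sum>i<K. \<alpha> (i + 1) * \<parallel>e i\<parallel>\<^sup>2)\<close>. The last iterate is treated as if one more step were done,
  with an exact gradient.
\<close>

section \<open>Smooth convex functions on a subspace\<close>

text \<open>Differentiability is known only within \<open>S\<close>. The line stays in
  \<open>S\<close>, so the chain rule within its image yields an ordinary derivative in
  \<open>t\<close>.\<close>

lemma has_real_derivative_line:
  fixes F :: "'a::real_inner \<Rightarrow> real"
  assumes S: "subspace S" "u \<in> S" "p \<in> S"
    and F: "\<And>x. x \<in> S \<Longrightarrow> (F has_derivative (\<lambda>h. F' x \<bullet> h)) (at x within S)"
  shows "((\<lambda>t. F (u + t *\<^sub>R p)) has_real_derivative F' (u + t *\<^sub>R p) \<bullet> p) (at t)"
proof -
  have line: "u + t *\<^sub>R p \<in> S" for t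
    using S by (simp add: subspace_add subspace_scale)
  have "((\<lambda>t. u + t *\<^sub>R p) has_derivative (\<lambda>h. h *\<^sub>R p)) (at t)"
    by (auto intro!: derivative_eq_intros)
  moreover have "(F has_derivative (\<lambda>h. F' (u + t *\<^sub>R p) \<bullet> h))
      (at (u + t *\<^sub>R p) within range (\<lambda>t. u + t *\<^sub>R p))"
    using line by (intro has_derivative_subset[OF F]) auto
  ultimately have "((\<lambda>t. F (u + t *\<^sub>R p)) has_derivative
      (\<lambda>h. F' (u + t *\<^sub>R p) \<bullet> (h *\<^sub>R p))) (at t)"
    by (rule has_derivative_in_compose)
  then show ?thesis
    by (simp add: has_field_derivative_def mult_commute_abs)
qed

text \<open>The slack \<open>\<psi>\<close> along the segment has nonpositive derivative for
  \<open>t \<ge> 0\<close>, by Cauchy-Schwarz and the Lipschitz bound. Comparing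
  \<open>\<psi> 1\<close> with \<open>\<psi> 0\<close> takes the place of integrating the
  gradient.\<close>

lemma descent_lemma:
  fixes F :: "'a::real_inner \<Rightarrow> real"
  assumes S: "subspace S" "u \<in> S" "p \<in> S"
    and F: "\<And>x. x \<in> S \<Longrightarrow> (F has_derivative (\<lambda>h. F' x \<bullet> h)) (at x within S)"
    and L: "L-lipschitz_on S F'"
  shows "F (u + p) \<le> F u + F' u \<bullet> p + L / 2 * (norm p)\<^sup>2"
proof -
  define \<psi> where "\<psi> t = F (u + t *\<^sub>R p) - t * (F' u \<bullet> p) - L / 2 * t\<^sup>2 * (norm p)\<^sup>2" for t
  have D: "(\<psi> has_real_derivative
      F' (u + t *\<^sub>R p) \<bullet> p - F' u \<bullet> p - L * t * (norm p)\<^sup>2) (at t)" for t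
  proof -
    have "((\<lambda>t. t * c + L / 2 * t\<^sup>2 * N) has_real_derivative c + L * t * N) (at t)" for c N
      by (auto intro!: derivative_eq_intros)
    from DERIV_diff[OF has_real_derivative_line[OF S F, of t] this]
    show ?thesis
      by (simp add: \<psi>_def [abs_def] diff_diff_eq)
  qed
  have nonpos: "F' (u + t *\<^sub>R p) \<bullet> p - F' u \<bullet> p - L * t * (norm p)\<^sup>2 \<le> 0" if "0 \<le> t" for t
  proof -
    have "u + t *\<^sub>R p \<in> S"
      using S by (simp add: subspace_add subspace_scale)
    then have "norm (F' (u + t *\<^sub>R p) - F' u) \<le> L * (t * norm p)"
      using lipschitz_onD[OF L, of "u + t *\<^sub>R p" u] S(2) that by (simp add: dist_norm)
    then have "norm (F' (u + t *\<^sub>R p) - F' u) * norm p \<le> L * (t * norm p) * norm p"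
      by (rule mult_right_mono) simp
    moreover have "(F' (u + t *\<^sub>R p) - F' u) \<bullet> p \<le> norm (F' (u + t *\<^sub>R p) - F' u) * norm p"
      by (rule norm_cauchy_schwarz)
    ultimately show ?thesis
      by (simp add: inner_diff_left power2_eq_square)
  qed
  have "\<psi> 1 \<le> \<psi> 0"
  proof (rule DERIV_nonpos_imp_nonincreasing[where f = \<psi>])
    show "\<exists>y. (\<psi> has_real_derivative y) (at t) \<and> y \<le> 0" if "0 \<le> t" for t
      by (intro exI conjI, rule D, rule nonpos[OF that])
  qed simp
  then show ?thesis
    by (simp add: \<psi>_def)
qed

lemma convex_on_gradient_inequality:
  fixes F :: "'a::real_inner \<Rightarrow> real"
  assumes S: "subspace S" "u \<in> S" "v \<in> S" and cvx: "convex_on S F"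
    and F: "\<And>x. x \<in> S \<Longrightarrow> (F has_derivative (\<lambda>h. F' x \<bullet> h)) (at x within S)"
  shows "F v + F' v \<bullet> (u - v) \<le> F u"
proof -
  have p: "u - v \<in> S"
    using S by (simp add: subspace_diff)
  have line: "v + t *\<^sub>R (u - v) \<in> S" for t
    using S p by (simp add: subspace_add subspace_scale)
  have "convex_on UNIV (\<lambda>t. F (v + t *\<^sub>R (u - v)))"
  proof (rule convex_onI)
    fix t a b :: real
    assume "0 < t" "t < 1"
    then have "F ((1 - t) *\<^sub>R (v + a *\<^sub>R (u - v)) + t *\<^sub>R (v + b *\<^sub>R (u - v)))
        \<le> (1 - t) * F (v + a *\<^sub>R (u - v)) + t * F (v + b *\<^sub>R (u - v))"
      by (intro convex_onD[OF cvx]) (use line in auto)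
    moreover have "(1 - t) *\<^sub>R (v + a *\<^sub>R (u - v)) + t *\<^sub>R (v + b *\<^sub>R (u - v))
        = v + ((1 - t) *\<^sub>R a + t *\<^sub>R b) *\<^sub>R (u - v)"
      by (simp add: algebra_simps)
    ultimately show "F (v + ((1 - t) *\<^sub>R a + t *\<^sub>R b) *\<^sub>R (u - v))
        \<le> (1 - t) * F (v + a *\<^sub>R (u - v)) + t * F (v + b *\<^sub>R (u - v))"
      by simp
  qed simp
  from convex_on_imp_above_tangent[OF this, of 0 1 "F' v \<bullet> (u - v)"]
  show ?thesis
    using has_real_derivative_line[OF S(1,3) p F, of 0] by simp
qed

text \<open>\<open>F (u + p)\<close> is squeezed between the tangent at \<open>v\<close> and the
  descent bound from \<open>u\<close>. The vector \<open>p\<close> is the gradient step with factor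
  \<open>1 / L\<close> for the tilted function \<open>\<lambda>x. F x - F' v \<bullet> x\<close>,
  whose minimum over \<open>S\<close> is at \<open>v\<close>.\<close>

lemma cocoercivity_inequality:
  fixes F :: "'a::real_inner \<Rightarrow> real"
  assumes S: "subspace S" "u \<in> S" "v \<in> S" and cvx: "convex_on S F"
    and F: "\<And>x. x \<in> S \<Longrightarrow> (F has_derivative (\<lambda>h. F' x \<bullet> h)) (at x within S)"
    and F': "\<And>x. x \<in> S \<Longrightarrow> F' x \<in> S"
    and L: "L > 0" "L-lipschitz_on S F'"
  shows "F v + F' v \<bullet> (u - v) + 1 / (2 * L) * (norm (F' u - F' v))\<^sup>2 \<le> F u"
proof -
  define p where "p = - (1 / L) *\<^sub>R (F' u - F' v)"
  have p: "p \<in> S"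
    unfolding p_def using S F' by (intro subspace_scale subspace_diff) auto
  have "F (u + p) \<le> F u + F' u \<bullet> p + L / 2 * (norm p)\<^sup>2"
    using S p by (intro descent_lemma[OF _ _ _ F L(2)])
  moreover have "F v + F' v \<bullet> (u + p - v) \<le> F (u + p)"
    using S p by (intro convex_on_gradient_inequality[OF _ _ _ cvx F]) (auto simp: subspace_add)
  moreover have "(norm p)\<^sup>2 = (norm (F' u - F' v))\<^sup>2 / L\<^sup>2"
    using L by (simp add: p_def power_divide power_mult_distrib)
  then have "L / 2 * (norm p)\<^sup>2 = 1 / (2 * L) * (norm (F' u - F' v))\<^sup>2"
    using L by (simp add: field_simps power2_eq_square)
  moreover have "F' u \<bullet> p - F' v \<bullet> p = - (1 / L) * (norm (F' u - F' v))\<^sup>2"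
    unfolding p_def inner_scaleR_right power2_norm_eq_inner inner_diff_left
    by (rule right_diff_distrib[symmetric])
  moreover have "F' v \<bullet> (u + p - v) = F' v \<bullet> (u - v) + F' v \<bullet> p"
    by (simp add: inner_diff_right inner_add_right)
  moreover have "1 / L * (norm (F' u - F' v))\<^sup>2 = 2 * (1 / (2 * L) * (norm (F' u - F' v))\<^sup>2)"
    by simp
  ultimately show ?thesis
    by linarith
qed

text \<open>A gradient step with factor \<open>1 / L\<close> lowers \<open>F\<close> by at least
  \<open>(norm (F' u))^2 / (2 * L)\<close>, which at a minimizer must be 0.\<close>

lemma gradient_eq_0_at_minimum:
  fixes F :: "'a::real_inner \<Rightarrow> real"
  assumes S: "subspace S" "u \<in> S" and min: "\<And>x. x \<in> S \<Longrightarrow> F u \<le> F x"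
    and F: "\<And>x. x \<in> S \<Longrightarrow> (F has_derivative (\<lambda>h. F' x \<bullet> h)) (at x within S)"
    and F': "\<And>x. x \<in> S \<Longrightarrow> F' x \<in> S"
    and L: "L > 0" "L-lipschitz_on S F'"
  shows "F' u = 0"
proof -
  define p where "p = - (1 / L) *\<^sub>R F' u"
  have p: "p \<in> S"
    unfolding p_def using S F' by (intro subspace_scale) auto
  have "F u \<le> F (u + p)"
    using S p by (intro min subspace_add)
  also have "\<dots> \<le> F u + F' u \<bullet> p + L / 2 * (norm p)\<^sup>2"
    by (rule descent_lemma[OF S p F L(2)])
  also have "\<dots> = F u - (norm (F' u))\<^sup>2 / (2 * L)"
    using L by (simp add: p_def power_divide power_mult_distrib field_simps power2_eq_square
        flip: power2_norm_eq_inner)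
  finally show ?thesis
    using L by (simp add: divide_le_0_iff)
qed

lemma convex_on_real_of_ereal:
  assumes S: "subspace S" and f: "\<And>x. x \<in> S \<Longrightarrow> \<bar>f x\<bar> \<noteq> \<infinity>" and cvx: "convex_fun_on S f"
  shows "convex_on S (\<lambda>x. real_of_ereal (f x))"
proof -
  have "f x \<le> ereal t \<longleftrightarrow> real_of_ereal (f x) \<le> t" if "x \<in> S" for x t
    using f[OF that] by (simp add: real_le_ereal_iff)
  then have "epi_on S f = epigraph S (\<lambda>x. real_of_ereal (f x))"
    by (auto simp: epi_on_def epigraph_def)
  then show ?thesis
    using cvx S by (simp add: convex_fun_on_def subspace_imp_convex convex_epigraph)
qed

section \<open>The step-size sequences\<close>

lemma A_coeff_pos: "A_coeff k > 0"
  and \<alpha>_coeff_ge_1: "\<alpha>_coeff k \<ge> 1"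
proof -
  have "A_coeff k > 0 \<and> \<alpha>_coeff k \<ge> 1"
  proof (induction k)
    case (Suc k)
    then have "\<alpha>_coeff (Suc k) \<ge> 1" by simp
    then show ?case using Suc unfolding A_coeff.simps by linarith
  qed simp
  then show "A_coeff k > 0" "\<alpha>_coeff k \<ge> 1" by auto
qed

lemma \<alpha>_coeff_nonneg: "0 \<le> \<alpha>_coeff k"
  using \<alpha>_coeff_ge_1[of k] by linarith

text \<open>By its recursion, \<open>\<alpha>_coeff (Suc j)\<close> is the positive root of
  \<open>t^2 = t + A_coeff j\<close>.\<close>

lemma A_coeff_eq: "A_coeff k = (\<alpha>_coeff k)\<^sup>2"
proof (cases k)
  case (Suc j)
  have "(sqrt (4 * A_coeff j + 1))\<^sup>2 = 4 * A_coeff j + 1"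
    using A_coeff_pos[of j] by simp
  then show ?thesis
    unfolding Suc by (simp add: field_simps power2_eq_square)
qed simp

declare A_coeff.simps(2) [simp del] \<alpha>_coeff.simps(2) [simp del]

lemma A_coeff_Suc_minus: "A_coeff (Suc k) - \<alpha>_coeff (Suc k) = A_coeff k"
  by (simp only: A_coeff.simps)

lemma A_coeff_mono: "i \<le> j \<Longrightarrow> A_coeff i \<le> A_coeff j"
proof (rule lift_Suc_mono_le[of A_coeff])
  show "A_coeff n \<le> A_coeff (Suc n)" for n
    using A_coeff_Suc_minus[of n] \<alpha>_coeff_ge_1[of "Suc n"] by linarith
qed

lemma \<alpha>_coeff_mono: "i \<le> j \<Longrightarrow> \<alpha>_coeff i \<le> \<alpha>_coeff j"
  using A_coeff_mono unfolding A_coeff_eq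
  by (rule power2_le_imp_le[OF _ \<alpha>_coeff_nonneg])

lemma sum_\<alpha>_coeff: "(\<Sum>i<K. \<alpha>_coeff (Suc i)) = A_coeff K - 1"
proof (induction K)
  case (Suc K)
  then show ?case
    using A_coeff_Suc_minus[of K] unfolding sum.lessThan_Suc by linarith
qed simp

text \<open>The square root in the recursion lies between \<open>2 * \<alpha>_coeff k\<close> and
  \<open>2 * \<alpha>_coeff k + 1\<close>, so each step adds between 1/2 and 1. Hence
  \<open>A_coeff K\<close> grows quadratically, as the final rate requires.\<close>

lemma \<alpha>_coeff_bounds:
  "\<alpha>_coeff k \<ge> 1 + real k / 2" "\<alpha>_coeff k \<le> 1 + real k"
proof -
  have step: "\<alpha>_coeff (Suc k) \<ge> \<alpha>_coeff k + 1 / 2 \<and> \<alpha>_coeff (Suc k) \<le> \<alpha>_coeff k + 1" for k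
  proof -
    have "sqrt (4 * A_coeff k + 1) \<ge> 2 * \<alpha>_coeff k"
      using \<alpha>_coeff_ge_1[of k] by (intro real_le_rsqrt) (simp add: A_coeff_eq power_mult_distrib)
    moreover have "sqrt (4 * A_coeff k + 1) \<le> 2 * \<alpha>_coeff k + 1"
      using \<alpha>_coeff_ge_1[of k]
      by (intro real_le_lsqrt) (auto simp: A_coeff_eq power2_eq_square algebra_simps)
    ultimately show ?thesis by (simp add: \<alpha>_coeff.simps(2))
  qed
  have "\<alpha>_coeff k \<ge> 1 + real k / 2 \<and> \<alpha>_coeff k \<le> 1 + real k"
  proof (induction k)
    case (Suc k)
    then show ?case
      using step[of k] unfolding of_nat_Suc by (auto simp: field_simps)
  qed simp
  then show "\<alpha>_coeff k \<ge> 1 + real k / 2" "\<alpha>_coeff k \<le> 1 + real k" by auto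
qed

section \<open>Error propagation in the potential\<close>

text \<open>Here \<open>w\<close> and \<open>w'\<close> stand for two consecutive differences
  \<open>z i - xs\<close>. Expanding the square of \<open>w'\<close> cancels
  \<open>a * (g \<bullet> w)\<close>, and \<open>s \<le> 2\<close> keeps the quadratic term within
  \<open>a^2 / L * (norm (g + e))^2\<close>. In units of \<open>D * (a * norm e)\<close>, the
  remaining errors cost 1 from \<open>e \<bullet> w\<close> and 4 from
  \<open>(g + e) \<bullet> e\<close>.\<close>

lemma dual_step_error:
  fixes w w' g e :: "'a::real_inner"
  assumes s: "1 \<le> s" "s \<le> 2" and L: "L > 0" and a: "a \<ge> 0"
    and w': "w' = w - (s / L * a) *\<^sub>R (g + e)"
    and D: "norm w \<le> D" "norm w' \<le> D"
  shows "a * (g \<bullet> w) - a\<^sup>2 / L * (norm g)\<^sup>2 + L / (2 * s) * ((norm w')\<^sup>2 - (norm w)\<^sup>2)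
    \<le> 5 * D * (a * norm e)"
proof -
  have D0: "0 \<le> D"
    using D(1) norm_ge_zero order.trans by blast
  have "(norm w')\<^sup>2 - (norm w)\<^sup>2
      = - 2 * (s / L * a) * ((g + e) \<bullet> w) + (s / L * a)\<^sup>2 * (norm (g + e))\<^sup>2"
    unfolding w' power2_norm_eq_inner
    by (simp add: inner_diff_left inner_diff_right inner_commute power2_eq_square
        algebra_simps add_divide_distrib)
  then have "L / (2 * s) * ((norm w')\<^sup>2 - (norm w)\<^sup>2)
      = - a * ((g + e) \<bullet> w) + s / 2 * (a\<^sup>2 / L * (norm (g + e))\<^sup>2)"
    using s L by (simp add: field_simps power2_eq_square)
  moreover have "s / 2 * (a\<^sup>2 / L * (norm (g + e))\<^sup>2) \<le> 1 * (a\<^sup>2 / L * (norm (g + e))\<^sup>2)"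
    using s L by (intro mult_right_mono) auto
  moreover have "(norm (g + e))\<^sup>2 - (norm g)\<^sup>2 \<le> 2 * ((g + e) \<bullet> e)"
    unfolding power2_norm_eq_inner by (simp add: inner_add_left inner_add_right inner_commute)
  then have "a\<^sup>2 / L * ((norm (g + e))\<^sup>2 - (norm g)\<^sup>2) \<le> a\<^sup>2 / L * (2 * ((g + e) \<bullet> e))"
    using L by (intro mult_left_mono) auto
  \<comment> \<open>The update trades a gradient of unknown size for the displacement
    \<open>w - w'\<close>, whose norm is at most \<open>2 * D\<close>.\<close>
  moreover have "a\<^sup>2 / L * (2 * ((g + e) \<bullet> e)) = 2 * a / s * ((w - w') \<bullet> e)"
  proof -
    have "(w - w') \<bullet> e = s / L * a * ((g + e) \<bullet> e)"
      by (simp add: w')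
    then show ?thesis
      using s by (simp add: power2_eq_square)
  qed
  moreover have "2 * a / s * ((w - w') \<bullet> e) \<le> 2 * a * (2 * D * norm e)"
  proof -
    have "norm (w - w') \<le> 2 * D"
      using norm_triangle_ineq4[of w w'] D by linarith
    then have "(w - w') \<bullet> e \<le> 2 * D * norm e"
      by (meson norm_cauchy_schwarz mult_right_mono norm_ge_zero order.trans)
    then have "2 * a / s * ((w - w') \<bullet> e) \<le> 2 * a / s * (2 * D * norm e)"
      using s a by (intro mult_left_mono) auto
    also have "\<dots> \<le> 2 * a * (2 * D * norm e)"
    proof (rule mult_right_mono)
      have "a \<le> s * a"
        using mult_right_mono[OF s(1) a] by simp
      then show "2 * a / s \<le> 2 * a"
        using s by (simp add: field_simps)
    qed (use D0 in simp)
    finally show ?thesis .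
  qed
  moreover have "- (e \<bullet> w) \<le> D * norm e"
  proof -
    have "\<bar>e \<bullet> w\<bar> \<le> norm e * norm w"
      by (rule Cauchy_Schwarz_ineq2)
    also have "\<dots> \<le> norm e * D"
      using D by (intro mult_left_mono) auto
    finally show ?thesis by (simp add: mult.commute)
  qed
  then have "a * (- (e \<bullet> w)) \<le> a * (D * norm e)"
    using a by (rule mult_left_mono)
  ultimately show ?thesis
    by (simp add: inner_add_left algebra_simps)
qed

text \<open>The gradient at a new point meets the previous error \<open>e\<close>, while
  \<open>e'\<close> is the error at the new point. Since \<open>s \<ge> 1\<close>, the displacement
  bounds \<open>a / L * norm (g + e')\<close> by \<open>2 * D\<close>; passing from \<open>g\<close>
  to \<open>g + e'\<close> leaves the second-order product of the two errors.\<close>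

lemma coupling_error:
  fixes w w' g e e' :: "'a::real_inner"
  assumes s: "1 \<le> s" and L: "L > 0" and a: "a > 0" and B: "0 \<le> B" "B \<le> a\<^sup>2"
    and w': "w' = w - (s / L * a) *\<^sub>R (g + e')"
    and D: "norm w \<le> D" "norm w' \<le> D"
  shows "- (B * (g \<bullet> e) / L) \<le> 2 * D * (a * norm e) + B * (norm e * norm e') / L"
proof -
  have D0: "0 \<le> D"
    using D(1) norm_ge_zero order.trans by blast
  have "norm (w - w') \<le> 2 * D"
    using norm_triangle_ineq4[of w w'] D by linarith
  moreover have "norm (w - w') = s / L * a * norm (g + e')"
    using s L a by (simp add: w')
  moreover have "1 * (a / L * norm (g + e')) \<le> s * (a / L * norm (g + e'))"
    using s L a by (intro mult_right_mono) auto
  ultimately have 1: "a / L * norm (g + e') \<le> 2 * D"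
    by simp
  have "norm g \<le> norm (g + e') + norm e'"
    using norm_triangle_ineq4[of "g + e'" e'] by simp
  then have "norm g * norm e \<le> (norm (g + e') + norm e') * norm e"
    by (rule mult_right_mono) simp
  then have "- (g \<bullet> e) \<le> (norm (g + e') + norm e') * norm e"
    using Cauchy_Schwarz_ineq2[of g e] by linarith
  then have "B / L * (- (g \<bullet> e)) \<le> B / L * ((norm (g + e') + norm e') * norm e)"
    using B L by (intro mult_left_mono) auto
  moreover have "B * (norm (g + e') * norm e / L) \<le> a\<^sup>2 * (norm (g + e') * norm e / L)"
    using B L by (intro mult_right_mono) auto
  moreover have "a\<^sup>2 * (norm (g + e') * norm e / L) = a / L * norm (g + e') * (a * norm e)"
    by (simp add: power2_eq_square)
  moreover have "\<dots> \<le> 2 * D * (a * norm e)"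
    using 1 a by (intro mult_right_mono) auto
  moreover have "B / L * ((norm (g + e') + norm e') * norm e)
      = B * (norm (g + e') * norm e / L) + B * (norm e * norm e') / L"
    by (simp add: algebra_simps add_divide_distrib)
  moreover have "B / L * (- (g \<bullet> e)) = - (B * (g \<bullet> e) / L)"
    by simp
  ultimately show ?thesis
    by linarith
qed

text \<open>Collects what the error analysis uses of a run: \<open>\<delta>\<close> is the reduced
  gap, \<open>g\<close> the exact gradients, \<open>e\<close> the errors and \<open>xs\<close> a
  minimizer. The exact step at index \<open>K\<close> supplies \<open>z (Suc K)\<close>.\<close>

locale inexact_potential =
  fixes s L :: real and K :: nat and \<delta> :: "nat \<Rightarrow> real"
    and g e z :: "nat \<Rightarrow> 'a::real_inner" and xs :: 'a
  assumes s: "1 \<le> s" "s \<le> 2" and L: "L > 0"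
    and gap_nonneg: "i \<le> K \<Longrightarrow> 0 \<le> \<delta> i"
    and last_exact: "e K = 0"
    and z_Suc: "i \<le> K \<Longrightarrow> z (Suc i) = z i - (s / L * \<alpha>_coeff i) *\<^sub>R (g i + e i)"
    and gap_0: "\<delta> 0 \<le> g 0 \<bullet> (z 0 - xs) - (norm (g 0))\<^sup>2 / L"
    and gap_Suc: "i < K \<Longrightarrow> A_coeff (Suc i) * \<delta> (Suc i) \<le> A_coeff i * \<delta> i
        + \<alpha>_coeff (Suc i) * (g (Suc i) \<bullet> (z (Suc i) - xs))
        - A_coeff (Suc i) / L * (norm (g (Suc i)))\<^sup>2 - A_coeff i * (g (Suc i) \<bullet> e i) / L"
begin

lemma z_diff: "i \<le> K \<Longrightarrow> z (Suc i) - xs = z i - xs - (s / L * \<alpha>_coeff i) *\<^sub>R (g i + e i)"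
  by (simp add: z_Suc)

text \<open>In the sum of the single-step estimates the gap and the distance telescope, and
  \<open>A_coeff i = (\<alpha>_coeff i)^2\<close> cancels the squared gradients. The weights 5 and 2
  come from \<open>dual_step_error\<close> and \<open>coupling_error\<close>.\<close>

lemma potential_bound:
  assumes D: "\<And>i. i \<le> Suc K \<Longrightarrow> norm (z i - xs) \<le> D" and "k \<le> K"
  shows "A_coeff k * \<delta> k + L / (2 * s) * (norm (z (Suc k) - xs))\<^sup>2
    \<le> L / (2 * s) * (norm (z 0 - xs))\<^sup>2
      + D * (5 * (\<Sum>i\<le>k. \<alpha>_coeff i * norm (e i)) + 2 * (\<Sum>i<k. \<alpha>_coeff (Suc i) * norm (e i)))
      + (\<Sum>i<k. A_coeff i * (norm (e i) * norm (e (Suc i)))) / L"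
  using \<open>k \<le> K\<close>
proof (induction k)
  case 0
  have "z (Suc 0) - xs = z 0 - xs - (s / L * 1) *\<^sub>R (g 0 + e 0)"
    using z_diff[of 0] by simp
  then have "1 * (g 0 \<bullet> (z 0 - xs)) - 1\<^sup>2 / L * (norm (g 0))\<^sup>2
      + L / (2 * s) * ((norm (z (Suc 0) - xs))\<^sup>2 - (norm (z 0 - xs))\<^sup>2) \<le> 5 * D * (1 * norm (e 0))"
    by (rule dual_step_error[OF s L zero_le_one _ D D]) simp_all
  then show ?case
    using gap_0 by (simp add: algebra_simps)
next
  case (Suc k)
  have "\<alpha>_coeff (Suc k) * (g (Suc k) \<bullet> (z (Suc k) - xs))
      - (\<alpha>_coeff (Suc k))\<^sup>2 / L * (norm (g (Suc k)))\<^sup>2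
      + L / (2 * s) * ((norm (z (Suc (Suc k)) - xs))\<^sup>2 - (norm (z (Suc k) - xs))\<^sup>2)
      \<le> 5 * D * (\<alpha>_coeff (Suc k) * norm (e (Suc k)))"
    using \<alpha>_coeff_ge_1[of "Suc k"] Suc.prems
    by (intro dual_step_error[OF s L _ z_diff] D) linarith+
  moreover have "- (A_coeff k * (g (Suc k) \<bullet> e k) / L)
      \<le> 2 * D * (\<alpha>_coeff (Suc k) * norm (e k)) + A_coeff k * (norm (e k) * norm (e (Suc k))) / L"
    using \<alpha>_coeff_ge_1[of "Suc k"] Suc.prems A_coeff_pos[of k] A_coeff_mono[of k "Suc k"]
    by (intro coupling_error[OF s(1) L _ _ _ z_diff] D) (auto simp only: A_coeff_eq)
  ultimately show ?case
    using gap_Suc[of k] Suc.IH Suc.prems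
    unfolding sum.lessThan_Suc sum.atMost_Suc A_coeff_eq[of "Suc k"]
    by (simp add: algebra_simps add_divide_distrib)
qed

section \<open>Bounds on the accumulated first- and second-order errors\<close>

definition "Q = (\<Sum>i<K. \<alpha>_coeff (Suc i) * (norm (e i))\<^sup>2)"

text \<open>\<open>e K = 0\<close> cuts the first sum to indices below \<open>K\<close>, and
  monotonicity raises \<open>\<alpha>_coeff i\<close> to
  \<open>\<alpha>_coeff (Suc i)\<close>.\<close>

lemma first_order_errors:
  assumes "k \<le> K"
  shows "5 * (\<Sum>i\<le>k. \<alpha>_coeff i * norm (e i)) + 2 * (\<Sum>i<k. \<alpha>_coeff (Suc i) * norm (e i))
    \<le> 7 * (\<Sum>i<K. \<alpha>_coeff (Suc i) * norm (e i))"
proof -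
  have "(\<Sum>i\<le>k. \<alpha>_coeff i * norm (e i)) \<le> (\<Sum>i\<le>K. \<alpha>_coeff i * norm (e i))"
    using assms \<alpha>_coeff_nonneg by (intro sum_mono2) auto
  also have "\<dots> = (\<Sum>i<K. \<alpha>_coeff i * norm (e i))"
    by (simp add: last_exact flip: lessThan_Suc_atMost)
  also have "\<dots> \<le> (\<Sum>i<K. \<alpha>_coeff (Suc i) * norm (e i))"
    by (intro sum_mono mult_right_mono \<alpha>_coeff_mono) auto
  finally have "(\<Sum>i\<le>k. \<alpha>_coeff i * norm (e i)) \<le> (\<Sum>i<K. \<alpha>_coeff (Suc i) * norm (e i))" .
  moreover have "(\<Sum>i<k. \<alpha>_coeff (Suc i) * norm (e i)) \<le> (\<Sum>i<K. \<alpha>_coeff (Suc i) * norm (e i))"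
    using assms \<alpha>_coeff_nonneg by (intro sum_mono2) auto
  ultimately show ?thesis by linarith
qed

lemma first_order_errors_squared:
  "(\<Sum>i<K. \<alpha>_coeff (Suc i) * norm (e i))\<^sup>2 \<le> A_coeff K * Q"
proof -
  \<comment> \<open>Splitting each weight into two square roots makes one Cauchy-Schwarz factor the
    sum of the weights, which is \<open>A_coeff K - 1\<close>.\<close>
  have "(\<Sum>i<K. sqrt (\<alpha>_coeff (Suc i)) * (sqrt (\<alpha>_coeff (Suc i)) * norm (e i)))\<^sup>2
      \<le> (\<Sum>i<K. (sqrt (\<alpha>_coeff (Suc i)))\<^sup>2) * (\<Sum>i<K. (sqrt (\<alpha>_coeff (Suc i)) * norm (e i))\<^sup>2)"
    by (rule Cauchy_Schwarz_ineq_sum)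
  then have "(\<Sum>i<K. \<alpha>_coeff (Suc i) * norm (e i))\<^sup>2 \<le> (\<Sum>i<K. \<alpha>_coeff (Suc i)) * Q"
    using \<alpha>_coeff_nonneg
    by (simp add: Q_def power_mult_distrib abs_of_nonneg flip: mult.assoc)
  also have "\<dots> \<le> A_coeff K * Q"
    unfolding sum_\<alpha>_coeff Q_def using \<alpha>_coeff_nonneg
    by (intro mult_right_mono sum_nonneg) auto
  finally show ?thesis .
qed

text \<open>Each product of neighbouring errors is at most the mean of their squares, and the
  shifted sum of squares gains only \<open>e K = 0\<close>.\<close>

lemma second_order_errors:
  assumes "k \<le> K"
  shows "(\<Sum>i<k. A_coeff i * (norm (e i) * norm (e (Suc i)))) \<le> A_coeff K * Q"
proof -
  have A: "0 \<le> A_coeff i" for i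
    using A_coeff_pos[of i] by linarith
  have "(\<Sum>i<k. A_coeff i * (norm (e i) * norm (e (Suc i))))
      \<le> (\<Sum>i<K. A_coeff i * (norm (e i) * norm (e (Suc i))))"
    using assms A by (intro sum_mono2) auto
  also have "\<dots> \<le> (\<Sum>i<K. A_coeff K * (((norm (e i))\<^sup>2 + (norm (e (Suc i)))\<^sup>2) / 2))"
  proof (intro sum_mono mult_mono A_coeff_mono)
    show "norm (e i) * norm (e (Suc i)) \<le> ((norm (e i))\<^sup>2 + (norm (e (Suc i)))\<^sup>2) / 2" for i
      using sum_squares_bound[of "norm (e i)" "norm (e (Suc i))"] by simp
  qed (use A in auto)
  also have "\<dots> = A_coeff K * (((\<Sum>i<K. (norm (e i))\<^sup>2) + (\<Sum>i<K. (norm (e (Suc i)))\<^sup>2)) / 2)"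
    by (simp add: sum.distrib flip: sum_distrib_left sum_divide_distrib)
  also have "\<dots> \<le> A_coeff K * Q"
  proof (rule mult_left_mono[OF _ A])
    have "(\<Sum>i<K. (norm (e (Suc i)))\<^sup>2) \<le> (\<Sum>i<Suc K. (norm (e i))\<^sup>2)"
      unfolding sum.lessThan_Suc_shift by simp
    also have "\<dots> = (\<Sum>i<K. (norm (e i))\<^sup>2)"
      by (simp add: last_exact)
    finally have "((\<Sum>i<K. (norm (e i))\<^sup>2) + (\<Sum>i<K. (norm (e (Suc i)))\<^sup>2)) / 2
        \<le> (\<Sum>i<K. 1 * (norm (e i))\<^sup>2)"
      by simp
    also have "\<dots> \<le> Q"
      unfolding Q_def by (intro sum_mono mult_right_mono \<alpha>_coeff_ge_1) simp
    finally show "((\<Sum>i<K. (norm (e i))\<^sup>2) + (\<Sum>i<K. (norm (e (Suc i)))\<^sup>2)) / 2 \<le> Q" .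
  qed
  finally show ?thesis .
qed

text \<open>The potential controls the square of the largest distance \<open>D\<close>, while the
  first-order errors enter linearly in \<open>D\<close>, so half of the quadratic term absorbs
  them.\<close>

lemma final_gap_bound:
  "A_coeff K * \<delta> K \<le> L * (norm (z 0 - xs))\<^sup>2 + 198 / L * (A_coeff K * Q)"
proof -
  \<comment> \<open>The maximum includes \<open>Suc K\<close>, because the potential at
    \<open>K\<close> involves \<open>z (Suc K)\<close>.\<close>
  define D where "D = Max ((\<lambda>i. norm (z i - xs)) ` {..Suc K})"
  define T where "T = (\<Sum>i<K. \<alpha>_coeff (Suc i) * norm (e i))"
  define R where "R = norm (z 0 - xs)"
  define V where "V = A_coeff K * Q / L"
  have D: "norm (z i - xs) \<le> D" if "i \<le> Suc K" for i
    unfolding D_def using that by (intro Max_ge) auto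
  have D0: "0 \<le> D"
    using D[of 0] norm_ge_zero order.trans by blast
  have T: "T\<^sup>2 \<le> A_coeff K * Q"
    unfolding T_def by (rule first_order_errors_squared)
  then have "T\<^sup>2 / L \<le> V"
    unfolding V_def using L by (intro divide_right_mono) auto
  have V0: "0 \<le> V"
    unfolding V_def using T L zero_le_power2[of T] by (intro divide_nonneg_pos) linarith+
  have pot: "A_coeff k * \<delta> k + L / (2 * s) * (norm (z (Suc k) - xs))\<^sup>2
      \<le> L / (2 * s) * R\<^sup>2 + 7 * (D * T) + V" if "k \<le> K" for k
  proof -
    have "D * (5 * (\<Sum>i\<le>k. \<alpha>_coeff i * norm (e i)) + 2 * (\<Sum>i<k. \<alpha>_coeff (Suc i) * norm (e i)))
        \<le> D * (7 * T)"
      unfolding T_def by (intro mult_left_mono first_order_errors that D0)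
    moreover have "(\<Sum>i<k. A_coeff i * (norm (e i) * norm (e (Suc i)))) / L \<le> V"
      unfolding V_def using L that by (intro divide_right_mono second_order_errors) auto
    ultimately show ?thesis
      using potential_bound[OF D that] unfolding R_def by simp
  qed
  \<comment> \<open>The square is completed with half of the potential's coefficient
    \<open>L / (2 * s)\<close>; \<open>s \<le> 2\<close> then turns \<open>49 * s\<close> into
    98.\<close>
  have young: "7 * (D * T) \<le> L / (4 * s) * D\<^sup>2 + 98 * V"
  proof -
    have "0 \<le> L / (4 * s) * (D - 14 * s / L * T)\<^sup>2"
      using s L by simp
    also have "\<dots> = L / (4 * s) * D\<^sup>2 - 7 * (D * T) + 49 * (s * (T\<^sup>2 / L))"
      using s L by (simp add: field_simps power2_eq_square)
    also have "s * (T\<^sup>2 / L) \<le> 2 * V"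
      using s \<open>T\<^sup>2 / L \<le> V\<close> L by (intro mult_mono) auto
    finally show ?thesis by simp
  qed
  obtain j where j: "j \<le> Suc K" "D = norm (z j - xs)"
  proof -
    have "D \<in> (\<lambda>i. norm (z i - xs)) ` {..Suc K}"
      unfolding D_def by (rule Max_in) auto
    then show ?thesis using that by auto
  qed
  \<comment> \<open>If the maximum is attained at index 0, then \<open>D = R\<close>. Otherwise the
    potential one index earlier applies, its gap term being nonnegative.\<close>
  have D2: "L / (2 * s) * D\<^sup>2 \<le> L / (2 * s) * R\<^sup>2 + 7 * (D * T) + V"
  proof (cases j)
    case 0
    moreover have "0 \<le> D * T"
      unfolding T_def using D0 \<alpha>_coeff_nonneg
      by (intro mult_nonneg_nonneg sum_nonneg) auto
    ultimately show ?thesis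
      using j V0 by (simp add: R_def)
  next
    case (Suc k)
    then have "k \<le> K" using j by simp
    then have "0 \<le> A_coeff k * \<delta> k"
      using gap_nonneg[of k] A_coeff_pos[of k] by simp
    then show ?thesis
      using pot[OF \<open>k \<le> K\<close>] unfolding j Suc by linarith
  qed
  have half: "L / (2 * s) * D\<^sup>2 = 2 * (L / (4 * s) * D\<^sup>2)" by simp
  have "A_coeff K * \<delta> K \<le> L / (2 * s) * R\<^sup>2 + 7 * (D * T) + V"
  proof -
    have "0 \<le> L / (2 * s) * (norm (z (Suc K) - xs))\<^sup>2"
      using s L by simp
    then show ?thesis
      using pot[of K] by linarith
  qed
  \<comment> \<open>With \<open>h = L / (4 * s) * D^2\<close>, \<open>D2\<close> and
    \<open>young\<close> give \<open>h \<le> L / (2 * s) * R^2 + 99 * V\<close>. Adding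
    \<open>98 * V\<close> bounds \<open>7 * (D * T)\<close>, and the extra \<open>V\<close> makes
    198.\<close>
  also have "\<dots> \<le> 2 * (L / (2 * s) * R\<^sup>2) + 198 * V"
    using young D2 unfolding half by linarith
  also have "2 * (L / (2 * s) * R\<^sup>2) = (L * R\<^sup>2) / s"
    by simp
  also have "\<dots> \<le> L * R\<^sup>2"
    using s L by (intro divide_left_mono[of 1 s, simplified]) auto
  finally show ?thesis
    by (simp add: R_def V_def)
qed

end

section \<open>The inexact methods\<close>

text \<open>Convexity and smoothness will be available on the subspace only, so the iterates must
  stay there. The invariant includes \<open>z\<close>, which is mixed into the next
  \<open>x\<close>.\<close>

lemma inexact_method_in_subspace:
  assumes m: "inexact_method s L K (\<lambda>k. f' (x k) + e k) x y z"
    and S: "subspace S" "x 0 \<in> S" and f': "\<And>u. u \<in> S \<Longrightarrow> f' u \<in> S"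
    and e: "\<And>k. k < K \<Longrightarrow> e k \<in> S"
  shows "k \<le> K \<Longrightarrow> x k \<in> S \<and> z k \<in> S"
proof (induction k)
  case 0
  then show ?case using m S by (simp add: inexact_method_def)
next
  case (Suc k)
  then have k: "k < K" and x: "x k \<in> S" and z: "z k \<in> S"
    by auto
  have g: "f' (x k) + e k \<in> S"
    using x k f' e S by (intro subspace_add)
  have "y (Suc k) = x k - (1 / L) *\<^sub>R (f' (x k) + e k)"
    using m k unfolding inexact_method_def by blast
  moreover have "z (Suc k) = z k - (s / L * \<alpha>_coeff k) *\<^sub>R (f' (x k) + e k)"
    using m k unfolding inexact_method_def by blast
  moreover have "x (Suc k) = (1 - \<alpha>_coeff (Suc k) / A_coeff (Suc k)) *\<^sub>R y (Suc k)
      + (\<alpha>_coeff (Suc k) / A_coeff (Suc k)) *\<^sub>R z (Suc k)"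
    using m k unfolding inexact_method_def by blast
  ultimately show ?case
    using S x z g by (simp add: subspace_add subspace_diff subspace_scale)
qed

lemma reduced_gap_eq:
  assumes "x\<^sub>s \<in> Rn d" "\<And>u. u \<in> Rn d \<Longrightarrow> f x\<^sub>s \<le> f u"
  shows "reduced_gap d L f f' u
    = real_of_ereal (f u) - real_of_ereal (f x\<^sub>s) - 1 / (2 * L) * (norm (f' u))\<^sup>2"
proof -
  have "(INF v\<in>Rn d. f v) = f x\<^sub>s"
    using assms by (intro antisym INF_lower INF_greatest)
  then show ?thesis by (simp add: reduced_gap_def)
qed

text \<open>Cocoercivity is applied to the pairs \<open>x\<^sub>s\<close>, \<open>x i\<close> and
  \<open>x i\<close>, \<open>x (Suc i)\<close>. Weighted by \<open>\<alpha>_coeff (Suc i)\<close>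
  and \<open>A_coeff i\<close>, the two bounds give the recursion of
  \<open>inexact_potential\<close>, uniformly in \<open>s\<close>.\<close>

lemma inexact_method_gap_bound:
  assumes prob: "problem_setting d L R f f' (x 0) x\<^sub>s" and err: "error_bound d K e b"
    and m: "inexact_method s L K (\<lambda>k. f' (x k) + e k) x y z" and s: "1 \<le> s" "s \<le> 2"
  shows "reduced_gap d L f f' (x K)
    \<le> L * R\<^sup>2 / A_coeff K + 198 / L * (\<Sum>i<K. \<alpha>_coeff (i + 1) * (b i)\<^sup>2)"
proof -
  define F where "F u = real_of_ereal (f u)" for u
  define \<delta> where "\<delta> i = F (x i) - F x\<^sub>s - 1 / (2 * L) * (norm (f' (x i)))\<^sup>2" for i
  \<comment> \<open>A fictitious exact step is appended at index \<open>K\<close>; the sequences are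
    unchanged before it.\<close>
  define e' where "e' = e(K := 0)"
  define z' where "z' = z(Suc K := z K - (s / L * \<alpha>_coeff K) *\<^sub>R f' (x K))"
  have L: "L > 0" and xs: "x\<^sub>s \<in> Rn d" and x0: "x 0 \<in> Rn d" and min: "\<And>u. u \<in> Rn d \<Longrightarrow> f x\<^sub>s \<le> f u"
    and R: "norm (x 0 - x\<^sub>s) \<le> R" and fin: "\<And>u. u \<in> Rn d \<Longrightarrow> \<bar>f u\<bar> \<noteq> \<infinity>"
    and f': "\<And>u. u \<in> Rn d \<Longrightarrow> f' u \<in> Rn d"
    and F: "\<And>u. u \<in> Rn d \<Longrightarrow> (F has_derivative (\<lambda>h. f' u \<bullet> h)) (at u within Rn d)"
    and lip: "L-lipschitz_on (Rn d) f'"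
    and cvx: "convex_on (Rn d) F"
    using prob convex_on_real_of_ereal[OF subspace_Rn, of d f]
    unfolding problem_setting_def lipschitz_smooth_on_def F_def by auto
  have x: "x k \<in> Rn d" if "k \<le> K" for k
    using inexact_method_in_subspace[OF m subspace_Rn x0 f' _ that] err
    by (auto simp: error_bound_def)
  have co: "F v + f' v \<bullet> (u - v) + 1 / (2 * L) * (norm (f' u - f' v))\<^sup>2 \<le> F u"
    if "u \<in> Rn d" "v \<in> Rn d" for u v
    by (rule cocoercivity_inequality[OF subspace_Rn that cvx F f' L lip])
  have F_min: "F x\<^sub>s \<le> F u" if "u \<in> Rn d" for u
    unfolding F_def using min[OF that] fin[OF that] fin[OF xs] by (simp flip: ereal_less_eq(3) add: ereal_real')
  have grad_min: "f' x\<^sub>s = 0"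
    by (rule gradient_eq_0_at_minimum[OF subspace_Rn xs F_min F f' L lip])
  have gap_dual: "\<delta> i \<le> f' (x i) \<bullet> (x i - x\<^sub>s) - (norm (f' (x i)))\<^sup>2 / L" if "i \<le> K" for i
  proof -
    have "(norm (f' (x i)))\<^sup>2 / L = 2 * (1 / (2 * L) * (norm (f' (x i)))\<^sup>2)" by simp
    then show ?thesis
      using co[OF xs x[OF that]] unfolding \<delta>_def by (simp add: grad_min inner_diff_right)
  qed
  have gap_primal: "\<delta> (Suc i) \<le> \<delta> i + f' (x (Suc i)) \<bullet> (x (Suc i) - y (Suc i))
      - (norm (f' (x (Suc i))))\<^sup>2 / L - (f' (x (Suc i)) \<bullet> e i) / L" if "i < K" for i
  proof -
    have y: "y (Suc i) = x i - (1 / L) *\<^sub>R (f' (x i) + e i)"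
      using m that by (simp add: inexact_method_def)
    define c where "c = 1 / (2 * L)"
    have c: "1 / (2 * L) = c" "1 / L = 2 * c" "t / L = 2 * c * t" for t
      by (simp_all add: c_def)
    \<comment> \<open>The mixed product in this square cancels the one produced by the gradient step
      to \<open>y (Suc i)\<close>, so that \<open>e i\<close> enters only through its product with
      the new gradient.\<close>
    have "(norm (f' (x i) - f' (x (Suc i))))\<^sup>2
        = (norm (f' (x i)))\<^sup>2 - 2 * (f' (x (Suc i)) \<bullet> f' (x i)) + (norm (f' (x (Suc i))))\<^sup>2"
      by (simp add: power2_norm_eq_inner inner_diff_left inner_diff_right inner_commute)
    from arg_cong[OF this, of "\<lambda>t. c * t"] show ?thesis
      using co[of "x i" "x (Suc i)"] x[of i] x[of "Suc i"] that unfolding \<delta>_def y c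
      by (simp add: inner_diff_right inner_add_right algebra_simps)
  qed
  interpret inexact_potential s L K \<delta> "\<lambda>i. f' (x i)" e' z' x\<^sub>s
  proof
    \<comment> \<open>Cocoercivity at the minimizer, where the gradient vanishes, yields exactly the
      gradient term subtracted in \<open>\<delta>\<close>.\<close>
    show "0 \<le> \<delta> i" if "i \<le> K" for i
      using co[OF x[OF that] xs] by (simp add: \<delta>_def grad_min)
    show "z' (Suc i) = z' i - (s / L * \<alpha>_coeff i) *\<^sub>R (f' (x i) + e' i)" if "i \<le> K" for i
      using m that by (cases "i = K") (auto simp: z'_def e'_def inexact_method_def)
    show "\<delta> 0 \<le> f' (x 0) \<bullet> (z' 0 - x\<^sub>s) - (norm (f' (x 0)))\<^sup>2 / L"
      using gap_dual[of 0] m by (simp add: z'_def inexact_method_def)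
    fix i assume i: "i < K"
    let ?A = "A_coeff (Suc i)" and ?a = "\<alpha>_coeff (Suc i)" and ?g = "f' (x (Suc i))"
    have A: "A_coeff i = ?A - ?a" "?A > 0" "?a > 0"
      using A_coeff_Suc_minus[of i] A_coeff_pos[of "Suc i"] \<alpha>_coeff_ge_1[of "Suc i"] by auto
    have ez: "e' i = e i" "z' (Suc i) = z (Suc i)"
      using i by (auto simp: e'_def z'_def)
    \<comment> \<open>In the weighted sum of \<open>gap_primal\<close> and \<open>gap_dual\<close>,
      this identity eliminates \<open>x (Suc i)\<close> and \<open>y (Suc i)\<close> in favour of
      \<open>z (Suc i)\<close>.\<close>
    have "?A *\<^sub>R x (Suc i) = A_coeff i *\<^sub>R y (Suc i) + ?a *\<^sub>R z (Suc i)"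
    proof -
      have "x (Suc i) = (1 - ?a / ?A) *\<^sub>R y (Suc i) + (?a / ?A) *\<^sub>R z (Suc i)"
        using m i unfolding inexact_method_def by blast
      then have "?A *\<^sub>R x (Suc i)
          = (?A * (1 - ?a / ?A)) *\<^sub>R y (Suc i) + (?A * (?a / ?A)) *\<^sub>R z (Suc i)"
        by (simp only: scaleR_add_right scaleR_scaleR)
      then show ?thesis
        using A by (simp add: right_diff_distrib)
    qed
    from arg_cong[OF this, of "\<lambda>v. ?g \<bullet> v"]
    have "?A * (?g \<bullet> x (Suc i)) = A_coeff i * (?g \<bullet> y (Suc i)) + ?a * (?g \<bullet> z (Suc i))"
      by (simp only: inner_add_right inner_scaleR_right)
    moreover have "A_coeff i * \<delta> (Suc i) \<le> A_coeff i * (\<delta> i + ?g \<bullet> (x (Suc i) - y (Suc i))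
      - (norm ?g)\<^sup>2 / L - (?g \<bullet> e i) / L)"
      using gap_primal[OF i] A_coeff_pos[of i] by (intro mult_left_mono) auto
    moreover have "?a * \<delta> (Suc i) \<le> ?a * (?g \<bullet> (x (Suc i) - x\<^sub>s) - (norm ?g)\<^sup>2 / L)"
      using gap_dual[of "Suc i"] i A by (intro mult_left_mono) auto
    ultimately show "?A * \<delta> (Suc i) \<le> A_coeff i * \<delta> i + ?a * (?g \<bullet> (z' (Suc i) - x\<^sub>s))
        - ?A / L * (norm ?g)\<^sup>2 - A_coeff i * (?g \<bullet> e' i) / L"
      unfolding ez A(1)
      by (simp add: inner_diff_right algebra_simps add_divide_distrib diff_divide_distrib)
  qed (use s L in \<open>auto simp: e'_def\<close>)
  have "Q \<le> (\<Sum>i<K. \<alpha>_coeff (i + 1) * (b i)\<^sup>2)"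
    unfolding Q_def Suc_eq_plus1 using err \<alpha>_coeff_nonneg
    by (intro sum_mono mult_left_mono) (auto simp: e'_def error_bound_def)
  then have "198 / L * Q \<le> 198 / L * (\<Sum>i<K. \<alpha>_coeff (i + 1) * (b i)\<^sup>2)"
    using L by (intro mult_left_mono) auto
  moreover have "L * (norm (z' 0 - x\<^sub>s))\<^sup>2 / A_coeff K \<le> L * R\<^sup>2 / A_coeff K"
    using R L A_coeff_pos[of K] m
    by (intro divide_right_mono mult_left_mono power_mono) (auto simp: z'_def inexact_method_def)
  moreover have "\<delta> K \<le> L * (norm (z' 0 - x\<^sub>s))\<^sup>2 / A_coeff K + 198 / L * Q"
    using final_gap_bound A_coeff_pos[of K] L by (simp add: field_simps)
  moreover have "reduced_gap d L f f' (x K) = \<delta> K"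
    using reduced_gap_eq[of x\<^sub>s d f L f' "x K"] xs min by (simp add: \<delta>_def F_def)
  ultimately show ?thesis by linarith
qed

section \<open>The constants of the theorem and the rate in \<open>K\<close>\<close>

theorem theorem5:
  shows "\<exists>c\<^sub>H>0::real.
    (\<forall>(d::nat) (L::real) (R::real) f f' x\<^sub>s (K::nat) e b x y z.
       problem_setting d L R f f' (x 0) x\<^sub>s \<and> 1 \<le> K \<and> error_bound d K e b \<longrightarrow>
       (iFGM L K (\<lambda>k. f' (x k) + e k) x y z \<longrightarrow>
          reduced_gap d L f f' (x K)
            \<le> 4 * L * R\<^sup>2 / A_coeff K + 2 * c\<^sub>H / L * (\<Sum>i<K. \<alpha>_coeff (i + 1) * (b i)\<^sup>2)) \<and>
       (iOGM L K (\<lambda>k. f' (x k) + e k) x y z \<longrightarrow>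
          reduced_gap d L f f' (x K)
            \<le> 4 * L * R\<^sup>2 / A_coeff K + 8 * c\<^sub>H / L * (\<Sum>i<K. \<alpha>_coeff (i + 1) * (b i)\<^sup>2))) \<and>
    (\<exists>C>0::real. \<forall>(d::nat) (L::real) (R::real) f f' x\<^sub>s (K::nat) e (\<beta>::real) x y z.
       problem_setting d L R f f' (x 0) x\<^sub>s \<and> 1 \<le> K \<and> error_bound d K e (\<lambda>i. \<beta>) \<and>
       iOGM L K (\<lambda>k. f' (x k) + e k) x y z \<longrightarrow>
          reduced_gap d L f f' (x K)
            \<le> C * (L * R\<^sup>2 / (real K)\<^sup>2 + (real K)\<^sup>2 * \<beta>\<^sup>2 / L))"
\<comment> \<open>One number serves as both constants: 198 is below \<open>2 * 792\<close> and
  \<open>8 * 792\<close>, and \<open>792 = 4 * 198\<close> comes from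
  \<open>A_coeff K \<le> 4 * K^2\<close>.\<close>
proof (intro exI[of _ "792::real"] conjI allI impI; (elim conjE)?)
  fix d L R f f' x\<^sub>s K e b and x y z :: "nat \<Rightarrow> (nat \<Rightarrow>\<^sub>0 real)"
  assume prob: "problem_setting d L R f f' (x 0) x\<^sub>s" and err: "error_bound d K e b"
  have L: "L > 0"
    using prob by (simp add: problem_setting_def)
  have LR: "L * R\<^sup>2 / A_coeff K \<le> 4 * L * R\<^sup>2 / A_coeff K"
    using L A_coeff_pos[of K] by (intro divide_right_mono) auto
  have Q: "0 \<le> 198 / L * (\<Sum>i<K. \<alpha>_coeff (i + 1) * (b i)\<^sup>2)"
    using L \<alpha>_coeff_nonneg
    by (intro mult_nonneg_nonneg sum_nonneg) auto
  show "reduced_gap d L f f' (x K)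
      \<le> 4 * L * R\<^sup>2 / A_coeff K + 2 * 792 / L * (\<Sum>i<K. \<alpha>_coeff (i + 1) * (b i)\<^sup>2)"
    if m: "iFGM L K (\<lambda>k. f' (x k) + e k) x y z"
    using inexact_method_gap_bound[OF prob err m] LR Q by simp
  show "reduced_gap d L f f' (x K)
      \<le> 4 * L * R\<^sup>2 / A_coeff K + 8 * 792 / L * (\<Sum>i<K. \<alpha>_coeff (i + 1) * (b i)\<^sup>2)"
    if m: "iOGM L K (\<lambda>k. f' (x k) + e k) x y z"
    using inexact_method_gap_bound[OF prob err m] LR Q by simp
next
  fix d L R f f' x\<^sub>s K e \<beta> and x y z :: "nat \<Rightarrow> (nat \<Rightarrow>\<^sub>0 real)"
  assume prob: "problem_setting d L R f f' (x 0) x\<^sub>s" and K: "1 \<le> K"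
    and err: "error_bound d K e (\<lambda>i. \<beta>)" and m: "iOGM L K (\<lambda>k. f' (x k) + e k) x y z"
  have L: "L > 0"
    using prob by (simp add: problem_setting_def)
  have K1: "1 \<le> real K"
    using K by simp
  have lower: "(real K)\<^sup>2 / 4 \<le> A_coeff K"
  proof -
    have "(real K / 2)\<^sup>2 \<le> (\<alpha>_coeff K)\<^sup>2"
      using \<alpha>_coeff_bounds(1)[of K] by (intro power_mono) auto
    then show ?thesis by (simp add: A_coeff_eq power_divide)
  qed
  \<comment> \<open>\<open>1 \<le> K\<close> turns the bound \<open>1 + K\<close> on
    \<open>\<alpha>_coeff K\<close> into \<open>2 * K\<close>.\<close>
  have upper: "A_coeff K \<le> 4 * (real K)\<^sup>2"
  proof -
    have "(\<alpha>_coeff K)\<^sup>2 \<le> (2 * real K)\<^sup>2"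
      using \<alpha>_coeff_bounds(2)[of K] \<alpha>_coeff_ge_1[of K] K1 by (intro power_mono) auto
    then show ?thesis by (simp add: A_coeff_eq power_mult_distrib)
  qed
  have "L * R\<^sup>2 / A_coeff K \<le> L * R\<^sup>2 / ((real K)\<^sup>2 / 4)"
    using lower L K1 by (intro divide_left_mono mult_pos_pos A_coeff_pos) auto
  also have "\<dots> = 4 * (L * R\<^sup>2 / (real K)\<^sup>2)"
    by simp
  also have "\<dots> \<le> 792 * (L * R\<^sup>2 / (real K)\<^sup>2)"
    using L by (intro mult_right_mono) auto
  finally have 1: "L * R\<^sup>2 / A_coeff K \<le> 792 * (L * R\<^sup>2 / (real K)\<^sup>2)" .
  have "(\<Sum>i<K. \<alpha>_coeff (i + 1) * \<beta>\<^sup>2) = (A_coeff K - 1) * \<beta>\<^sup>2"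
    unfolding Suc_eq_plus1[symmetric] sum_\<alpha>_coeff[symmetric] by (rule sum_distrib_right[symmetric])
  also have "\<dots> \<le> 4 * (real K)\<^sup>2 * \<beta>\<^sup>2"
    using upper by (intro mult_right_mono) auto
  finally have "198 / L * (\<Sum>i<K. \<alpha>_coeff (i + 1) * \<beta>\<^sup>2) \<le> 198 / L * (4 * (real K)\<^sup>2 * \<beta>\<^sup>2)"
    using L by (intro mult_left_mono) auto
  then show "reduced_gap d L f f' (x K)
      \<le> 792 * (L * R\<^sup>2 / (real K)\<^sup>2 + (real K)\<^sup>2 * \<beta>\<^sup>2 / L)"
    using inexact_method_gap_bound[OF prob err m] 1 by simp
qed simp_all

end
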